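(* As $n\to\infty$, \[ \mu_n= \frac{G\left(\log_\kappa\frac{n}{\log_\kappa n}\right)}{\sqrt{2\pi}}\cdot\frac{n^{1/\log\kappa+1/2}}{\log_\kappa n}\,\exp\left(\frac{\left(\log \frac{n}{\log_\kappa n}\right)^2}{2\log\kappa}\right)\left(1+O\left(\frac{(\log\log n)^2}{\log n}\right)\right), \] where \[ G(u) = q^{(\{u\}^2-\{u\})/2}\sum_{j\in\mathbb{Z}}\frac{q^{j(j+1)/2}}{1+q^{j-\{u\}}}\, q^{-j\{u\}} \] ($\{u\}$ being the fractional part of $u$) is a bounded, $1$-periodic function of $u\in\mathbb{R}$.
   Context: Fix $0<p<1$, $q=1-p$, $\kappa=1/q$; $\log$ is the natural logarithm and $\log_\kappa x=\log x/\log\kappa$. Let $\mu_n$ be the expected cost (total number of recursive calls) of the exhaustive search algorithm for a maximum independent set based on $\alpha(H)=\max\{\alpha(H\setminus\{v\}),\,1+\alpha(H\setminus N^*(v))\}$ ($N^*(v)$ is $v$ together with its neighbours, $\alpha$ the stability number), run on a random graph with $n$ vertices in which each edge is present independently with probability $p$. Precisely, $(\mu_n)_{n\ge0}$ is the sequence determined by $\mu_0=0$, $\mu_1=1$ and \[ \mu_n=\mu_{n-1}+\sum_{0\le k<n}\pi_{n,k}\mu_k\quad(n\ge2),\qquad \pi_{n,k}=\binom{n-1}{k}q^kp^{n-1-k}. \] The constant implied in $O$ may depend on $p$. *)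

theory Defs
  imports "HOL-Analysis.Analysis" "HOL-Library.Landau_Symbols"
begin

definition trans_prob :: "real \<Rightarrow> nat \<Rightarrow> nat \<Rightarrow> real" where
  "trans_prob p n k = real ((n - 1) choose k) * (1 - p) ^ k * p ^ (n - 1 - k)"

text \<open>The congruence rule for sums supplies the bound on the summation index
  that termination needs.\<close>

function mis_cost :: "real \<Rightarrow> nat \<Rightarrow> real" where
  "mis_cost p n =
     (if n = 0 then 0
      else if n = 1 then 1
      else mis_cost p (n - 1) + (\<Sum>k<n. trans_prob p n k * mis_cost p k))"
  by pat_completeness auto
termination
  by (relation "Wellfounded.measure snd") auto

declare mis_cost.simps [simp del]

lemma mis_cost_0: "mis_cost p 0 = 0"
  and mis_cost_1: "mis_cost p 1 = 1"
  and mis_cost_rec: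
    "n \<ge> 2 \<Longrightarrow> mis_cost p n = mis_cost p (n - 1) + (\<Sum>k<n. trans_prob p n k * mis_cost p k)"
  by (subst mis_cost.simps; simp)+

text \<open>The exponents of \<open>q\<close> below are real, hence \<open>powr\<close>, which is
  the ordinary power because \<open>q > 0\<close>.\<close>

definition G_summand :: "real \<Rightarrow> real \<Rightarrow> int \<Rightarrow> real" where
  "G_summand q u j =
     q powr (real_of_int (j * (j + 1)) / 2) / (1 + q powr (real_of_int j - frac u))
       * q powr (- (real_of_int j * frac u))"

text \<open>The unordered sum \<open>infsum\<close> is \<open>0\<close> for a non-summable family.\<close>

definition G :: "real \<Rightarrow> real \<Rightarrow> real" where
  "G q u = q powr (((frac u)\<^sup>2 - frac u) / 2) * infsum (G_summand q u) UNIV"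

end

theory Submission
  imports Defs "HOL-Real_Asymp.Real_Asymp"
begin

text \<open>
  Write \<open>L = log\<^sub>\<kappa> n\<close> and \<open>u = log\<^sub>\<kappa> (n / L)\<close>, so that \<open>q\<^sup>u = L / n\<close>. All sums
  below have nonnegative terms, so that nothing cancels.

  For \<open>n \<ge> 1\<close> the recurrence says that \<open>\<mu>\<^sub>n\<^sub>+\<^sub>1 - \<mu>\<^sub>n\<close> is the average of \<open>\<mu>\<close> over a binomial
  variable with parameters \<open>n\<close> and \<open>q\<close>; call this average the thinning of \<open>\<mu>\<close>. Sorting the
  contributions to \<open>\<mu>\<^sub>n\<close> by the number \<open>k\<close> of thinnings that they went through before they
  reach the initial jump from \<open>\<mu>\<^sub>0 = 0\<close> to \<open>\<mu>\<^sub>1 = 1\<close> yields the exact formula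
  (\<open>mis_cost_eq_sum\<close>)
  \<open>\<mu>\<^sub>n = (\<Sum>k<n. q\<^bsup>k(k+1)/2\<^esup> S\<^sub>k)\<close> with
  \<open>S\<^sub>k = (\<Sum>m<n. (m choose k) (1 - q\<^sup>k)\<^bsup>n-1-m\<^esup>)\<close>.

  Summation by parts confines \<open>S\<^sub>k\<close> so tightly (\<open>damped_binomial_sum_lower\<close>,
  \<open>damped_binomial_sum_upper\<close>) that \<open>S\<^sub>k \<approx> (n\<^bsup>k+1\<^esup> / (k! k)) / (1 + q\<^sup>k n / k)\<close> up to a factor
  \<open>1 + O(1 / k) + O(k\<^sup>2 / n)\<close>. The terms that matter have
  \<open>k\<close> close to \<open>u\<close>, hence close to \<open>L\<close>, and there Stirling's formula gives
  \<open>k! = sqrt (2 \<pi> L) L\<^sup>k e\<^bsup>-L\<^esup> (1 + O((k - L)\<^sup>2 / L))\<close>. Completing the square in the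
  exponent turns the \<open>k\<close>-th term into a factor that depends on \<open>n\<close> only (\<open>cost_scale\<close>)
  times \<open>\<phi>(w) = q\<^bsup>(w\<^sup>2+w)/2\<^esup> / (1 + q\<^sup>w)\<close> at \<open>w = k - u\<close>, and \<open>G u\<close> is the sum of
  \<open>\<phi>(k - u)\<close> over all integers \<open>k\<close> (\<open>G_eq_profile_sum\<close>). The weight \<open>q\<^bsup>w\<^sup>2/2\<^esup>\<close> leaves only
  boundedly many values of \<open>k\<close> with a substantial share, which is why the sum does not become an
  integral and an oscillating factor survives.

  The error term has one source: \<open>k - L\<close> is of order \<open>W = log\<^sub>\<kappa> L\<close>, the difference between \<open>L\<close>
  and \<open>u\<close>, so that Stirling's formula costs \<open>W\<^sup>2 / L\<close>, which is of order
  \<open>(log log n)\<^sup>2 / log n\<close>. This is uniform for \<open>\<bar>w\<bar> \<le> W\<close> (\<open>scaled_sum_window\<close>). For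
  \<open>\<bar>w\<bar> > W\<close> the trivial bounds \<open>S\<^sub>k \<le> (n choose (k + 1))\<close> and \<open>L\<^sup>m / m! \<le> e\<^sup>L\<close> lose only a
  factor of order \<open>sqrt L\<close>, and \<open>q\<^bsup>W\<^sup>2/4\<^esup>\<close> is smaller than any power of \<open>1 / L\<close>.
\<close>

section \<open>The cost as a sum of nonnegative terms\<close>

definition thinning :: "real \<Rightarrow> (nat \<Rightarrow> real) \<Rightarrow> nat \<Rightarrow> real" where
  "thinning q f n = (\<Sum>i\<le>n. real (n choose i) * q ^ i * (1 - q) ^ (n - i) * f i)"

lemma thinning_0: "thinning q f 0 = f 0"
  by (simp add: thinning_def)

lemma thinning_add: "thinning q (\<lambda>i. f i + g i) n = thinning q f n + thinning q g n"
  by (simp add: thinning_def algebra_simps sum.distrib)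

lemma thinning_cmult: "thinning q (\<lambda>i. c * f i) n = c * thinning q f n"
  by (simp add: thinning_def sum_distrib_left algebra_simps)

lemma thinning_sum: "thinning q (\<lambda>i. \<Sum>k\<in>A. f k i) n = (\<Sum>k\<in>A. thinning q (f k) n)"
  unfolding thinning_def sum_distrib_left by (rule sum.swap)

lemma thinning_cong: "(\<And>i. i \<le> n \<Longrightarrow> f i = g i) \<Longrightarrow> thinning q f n = thinning q g n"
  by (simp add: thinning_def)

text \<open>A binomial variable with \<open>n + 1\<close> trials is conditioned on the outcome of one of them. The
  lemma lets thinnings be computed by induction from recurrences in the argument.\<close>
lemma thinning_Suc:
  "thinning q f (Suc n) = (1 - q) * thinning q f n + q * thinning q (\<lambda>i. f (Suc i)) n"
proof -
  let ?p = "1 - q"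
  have "thinning q f (Suc n) = ?p ^ Suc n * f 0
      + (\<Sum>i\<le>n. real ((n choose i) + (n choose Suc i)) * q ^ Suc i * ?p ^ (n - i) * f (Suc i))"
    unfolding thinning_def by (subst sum.atMost_Suc_shift) simp
  also have "\<dots> = ?p ^ Suc n * f 0
      + (\<Sum>i\<le>n. real (n choose Suc i) * q ^ Suc i * ?p ^ (n - i) * f (Suc i))
      + q * thinning q (\<lambda>i. f (Suc i)) n"
    by (simp add: thinning_def sum_distrib_left sum.distrib algebra_simps)
  also have "?p ^ Suc n * f 0
      + (\<Sum>i\<le>n. real (n choose Suc i) * q ^ Suc i * ?p ^ (n - i) * f (Suc i))
      = (\<Sum>i\<le>Suc n. real (n choose i) * q ^ i * ?p ^ (Suc n - i) * f i)"
    by (subst sum.atMost_Suc_shift) simp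
  also have "\<dots> = (\<Sum>i\<le>n. real (n choose i) * q ^ i * ?p ^ (Suc n - i) * f i)"
    by simp
  also have "\<dots> = ?p * thinning q f n"
    unfolding thinning_def sum_distrib_left by (rule sum.cong) (simp_all add: Suc_diff_le)
  finally show ?thesis .
qed

lemma thinning_binomial: "thinning q (\<lambda>i. real (i choose k)) n = q ^ k * real (n choose k)"
proof (induction n arbitrary: k)
  case 0
  then show ?case by (cases k) (simp_all add: thinning_0)
next
  case (Suc n)
  show ?case
  proof (cases k)
    case 0
    then show ?thesis using Suc[of 0] by (simp add: thinning_Suc algebra_simps)
  next
    case (Suc l)
    then show ?thesis using Suc.IH[of k] Suc.IH[of l]
      by (simp add: thinning_Suc thinning_add algebra_simps)
  qed
qed

text \<open>This is the solution of \<open>x\<^sub>n\<^sub>+\<^sub>1 = (1 - a) x\<^sub>n + (n choose k)\<close> with \<open>x\<^sub>0 = 0\<close>, a family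
  that thinning maps to itself, with \<open>a\<close> replaced by \<open>a q\<close>.\<close>
definition damped_binomial_sum :: "real \<Rightarrow> nat \<Rightarrow> nat \<Rightarrow> real" where
  "damped_binomial_sum a k n = (\<Sum>m<n. real (m choose k) * (1 - a) ^ (n - Suc m))"

lemma damped_binomial_sum_0: "damped_binomial_sum a k 0 = 0"
  by (simp add: damped_binomial_sum_def)

lemma damped_binomial_sum_Suc:
  "damped_binomial_sum a k (Suc n) = (1 - a) * damped_binomial_sum a k n + real (n choose k)"
proof -
  have "(\<Sum>m<n. real (m choose k) * (1 - a) ^ (Suc n - Suc m))
      = (1 - a) * (\<Sum>m<n. real (m choose k) * (1 - a) ^ (n - Suc m))"
    unfolding sum_distrib_left
    by (rule sum.cong) (auto simp: Suc_diff_Suc simp flip: power_Suc)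
  then show ?thesis by (simp add: damped_binomial_sum_def)
qed

lemma damped_binomial_sum_eq_0: "n \<le> k \<Longrightarrow> damped_binomial_sum a k n = 0"
  by (simp add: damped_binomial_sum_def sum.neutral)

lemma damped_binomial_sum_1_0: "n > 0 \<Longrightarrow> damped_binomial_sum 1 0 n = 1"
  by (cases n) (simp_all add: damped_binomial_sum_Suc)

text \<open>Both sides solve the recurrence \<open>x\<^sub>n\<^sub>+\<^sub>1 = (1 - a q) x\<^sub>n + q\<^bsup>k+1\<^esup> (n choose k)\<close>: in the left side
  the coefficient arises as \<open>(1 - q) + q (1 - a)\<close>.\<close>
lemma thinning_damped_binomial_sum:
  "thinning q (damped_binomial_sum a k) n = q ^ Suc k * damped_binomial_sum (a * q) k n"
proof (induction n)
  case (Suc n)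
  have "thinning q (damped_binomial_sum a k) (Suc n)
      = (1 - q) * thinning q (damped_binomial_sum a k) n
        + q * ((1 - a) * thinning q (damped_binomial_sum a k) n + q ^ k * real (n choose k))"
    by (simp add: thinning_Suc damped_binomial_sum_Suc thinning_add thinning_cmult
        thinning_binomial)
  then show ?case by (simp add: Suc damped_binomial_sum_Suc algebra_simps)
qed (simp add: thinning_0 damped_binomial_sum_0)

text \<open>Summation by parts, with \<open>(m choose k)\<close> as the forward difference of
  \<open>(m choose (k + 1))\<close>. It serves twice: it makes the terms of the exact formula fit the
  recurrence, and it links consecutive \<open>k\<close>, from which the size of the sums is read off.\<close>
lemma damped_binomial_sum_by_parts:
  "damped_binomial_sum a k n = real (n choose Suc k) - a * damped_binomial_sum a (Suc k) n"
proof (induction n)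
  case (Suc n)
  have "damped_binomial_sum a k (Suc n)
      = (1 - a) * (real (n choose Suc k) - a * damped_binomial_sum a (Suc k) n) + real (n choose k)"
    unfolding damped_binomial_sum_Suc Suc ..
  also have "\<dots> = real (Suc n choose Suc k) - a * damped_binomial_sum a (Suc k) (Suc n)"
    by (simp add: damped_binomial_sum_Suc algebra_simps)
  finally show ?case .
qed (simp add: damped_binomial_sum_0)

definition cost_summand :: "real \<Rightarrow> nat \<Rightarrow> nat \<Rightarrow> real" where
  "cost_summand q n k = q ^ (k * (k + 1) div 2) * damped_binomial_sum (q ^ k) k n"

text \<open>The increment of one term in \<open>n\<close> is the thinning of the preceding term. Summed over \<open>k\<close> this
  is the recurrence for the cost; the factor \<open>q\<^bsup>k(k+1)/2\<^esup>\<close> accumulates the factors \<open>q\<^bsup>k+1\<^esup>\<close>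
  that the thinnings produce.\<close>
lemma cost_summand_step:
  "cost_summand q (Suc n) (Suc k) - cost_summand q n (Suc k)
     = thinning q (\<lambda>i. cost_summand q i k) n"
proof -
  have tri: "Suc k * (Suc k + 1) div 2 = k * (k + 1) div 2 + Suc k"
    by (simp add: algebra_simps)
  have "thinning q (damped_binomial_sum a k) n = q ^ Suc k * damped_binomial_sum (q * a) k n" for a
    by (simp add: thinning_damped_binomial_sum mult.commute)
  then have "thinning q (\<lambda>i. cost_summand q i k) n
      = q ^ (k * (k + 1) div 2) * (q ^ Suc k * damped_binomial_sum (q ^ Suc k) k n)"
    by (simp add: cost_summand_def thinning_cmult)
  also have "\<dots> = q ^ (Suc k * (Suc k + 1) div 2) *
      (real (n choose Suc k) - q ^ Suc k * damped_binomial_sum (q ^ Suc k) (Suc k) n)"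
    unfolding tri power_add
    by (subst damped_binomial_sum_by_parts) (simp only: mult_ac)
  finally show ?thesis
    by (simp add: cost_summand_def damped_binomial_sum_Suc algebra_simps)
qed

lemma cost_summand_eq_0: "n \<le> k \<Longrightarrow> cost_summand q n k = 0"
  by (simp add: cost_summand_def damped_binomial_sum_eq_0)

text \<open>The term \<open>k = 0\<close> has constant value \<open>1\<close> for \<open>n \<ge> 1\<close>; it supplies the initial value
  \<open>\<mu>\<^sub>1 = 1\<close> and has no increments of its own, so that \<open>cost_summand_step\<close> accounts for
  everything else.\<close>
lemma mis_cost_eq_sum: "mis_cost p n = (\<Sum>k<n. cost_summand (1 - p) n k)"
proof (induction n rule: less_induct)
  case (less n)
  let ?q = "1 - p"
  consider "n = 0" | "n = 1" | m where "n = Suc m" "m > 0"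
    by (metis One_nat_def not0_implies_Suc not_gr0)
  then show ?case
  proof cases
    case 1
    then show ?thesis by (simp add: mis_cost_0)
  next
    case 2
    then show ?thesis using mis_cost_1[of p] by (simp add: cost_summand_def damped_binomial_sum_Suc
          damped_binomial_sum_0)
  next
    case (3 m)
    \<comment> \<open>One range of summation for all \<open>i \<le> m\<close>, so that thinning can be exchanged with the sum.\<close>
    have ext: "mis_cost p i = (\<Sum>k<m. cost_summand ?q i k)" if "i \<le> m" for i
    proof -
      have "(\<Sum>k<i. cost_summand ?q i k) = (\<Sum>k<m. cost_summand ?q i k)"
        by (rule sum.mono_neutral_left) (use that in \<open>auto simp: cost_summand_eq_0\<close>)
      then show ?thesis using less[of i] that 3 by simp
    qed
    have "mis_cost p n - mis_cost p m = (\<Sum>k\<le>m. trans_prob p n k * mis_cost p k)"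
      using 3 by (simp add: mis_cost_rec lessThan_Suc_atMost)
    also have "\<dots> = thinning ?q (mis_cost p) m"
      by (simp add: thinning_def trans_prob_def 3 mult_ac)
    also have "\<dots> = thinning ?q (\<lambda>i. \<Sum>k<m. cost_summand ?q i k) m"
      by (rule thinning_cong) (rule ext)
    also have "\<dots> = (\<Sum>k<m. cost_summand ?q n (Suc k) - cost_summand ?q m (Suc k))"
      by (simp add: thinning_sum cost_summand_step 3)
    also have "\<dots> = (\<Sum>k<Suc m. cost_summand ?q n k - cost_summand ?q m k)"
      using 3 by (subst sum.lessThan_Suc_shift) (simp add: cost_summand_def damped_binomial_sum_1_0)
    also have "\<dots> = (\<Sum>k<n. cost_summand ?q n k) - mis_cost p m"
      using 3 ext[of m] by (simp add: sum_subtractf cost_summand_eq_0)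
    finally show ?thesis by simp
  qed
qed

section \<open>Two-sided bounds for the damped binomial sums\<close>

lemma damped_binomial_sum_nonneg: "a \<le> 1 \<Longrightarrow> damped_binomial_sum a k n \<ge> 0"
  by (simp add: damped_binomial_sum_def sum_nonneg)

lemma damped_binomial_sum_le_choose:
  assumes "0 \<le> a" "a \<le> 1"
  shows "damped_binomial_sum a k n \<le> real (n choose Suc k)"
  using damped_binomial_sum_by_parts[of a k n] damped_binomial_sum_nonneg[of a "Suc k" n] assms
  by (simp add: mult_nonneg_nonneg)

lemma choose_Suc_absorb:
  "real (Suc k) * real (m choose Suc k) = (real m - real k) * real (m choose k)"
proof (cases "k \<le> m")
  case True
  have "Suc k * (m choose Suc k) = (m - k) * (m choose k)"
    by (metis binomial_absorb_comp binomial_absorption mult.commute)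
  then show ?thesis using True by (metis of_nat_diff of_nat_mult)
qed (simp add: binomial_eq_0)

text \<open>Termwise, \<open>(k + 1) (m choose (k + 1)) = (m - k) (m choose k)\<close>, and \<open>m \<le> n - 1\<close> in the sum.\<close>
lemma damped_binomial_sum_ratio:
  assumes "a \<le> 1"
  shows "real (Suc k) * damped_binomial_sum a (Suc k) n
           \<le> (real n - 1 - real k) * damped_binomial_sum a k n"
proof -
  have "real (Suc k) * damped_binomial_sum a (Suc k) n
      = (\<Sum>m<n. (real m - real k) * (real (m choose k) * (1 - a) ^ (n - Suc m)))"
    unfolding damped_binomial_sum_def sum_distrib_left
    by (rule sum.cong) (simp_all only: choose_Suc_absorb flip: mult.assoc)
  also have "\<dots> \<le> (\<Sum>m<n. (real n - 1 - real k) * (real (m choose k) * (1 - a) ^ (n - Suc m)))"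
    using assms by (intro sum_mono mult_right_mono) auto
  finally show ?thesis by (simp add: damped_binomial_sum_def sum_distrib_left)
qed

text \<open>In \<open>S\<^sub>k = (n choose (k + 1)) - a S\<^sub>k\<^sub>+\<^sub>1\<close> the last sum is at most
  \<open>n / (k + 1)\<close> times \<open>S\<^sub>k\<close>; the resulting inequality is solved for \<open>S\<^sub>k\<close>.\<close>
lemma damped_binomial_sum_lower:
  assumes "0 \<le> a" "a \<le> 1"
  shows "real (n choose Suc k) / (1 + a * real n / real (Suc k)) \<le> damped_binomial_sum a k n"
proof -
  let ?S = "damped_binomial_sum a"
  have "real (Suc k) * ?S (Suc k) n \<le> real n * ?S k n"
    using damped_binomial_sum_ratio[of a k n] damped_binomial_sum_nonneg[of a k n] assms
    by (smt (verit) mult_right_mono of_nat_0_le_iff)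
  then have "?S (Suc k) n \<le> real n / real (Suc k) * ?S k n"
    by (simp add: field_simps del: of_nat_Suc)
  then have "a * ?S (Suc k) n \<le> a * (real n / real (Suc k) * ?S k n)"
    using assms by (intro mult_left_mono)
  then have "real (n choose Suc k) \<le> ?S k n * (1 + a * real n / real (Suc k))"
    unfolding distrib_left mult_1_right using damped_binomial_sum_by_parts[of a k n]
    by (simp only: mult_ac times_divide_eq_left times_divide_eq_right)
  moreover have "1 + a * real n / real (Suc k) > 0"
    using assms by (intro add_pos_nonneg) auto
  ultimately show ?thesis by (simp add: pos_divide_le_eq)
qed

text \<open>The same two facts one index lower: \<open>(n choose k) - a S\<^sub>k = S\<^sub>k\<^sub>-\<^sub>1 \<ge> (k / n) S\<^sub>k\<close>.
  The two bounds for \<open>S\<^sub>k\<close> agree up to a factor \<open>1 + O(1 / k) + O(k / n)\<close>.\<close>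
lemma damped_binomial_sum_upper:
  assumes "0 \<le> a" "a \<le> 1" "0 < k" "0 < n"
  shows "damped_binomial_sum a k n \<le> real (n choose k) / (a + real k / real n)"
proof -
  let ?S = "damped_binomial_sum a"
  obtain l where l: "k = Suc l" using assms by (cases k) auto
  have "real k * ?S k n \<le> (real n - real k) * ?S l n"
    using damped_binomial_sum_ratio[of a l n] assms l by (simp add: algebra_simps)
  also have "\<dots> \<le> real n * ?S l n"
    using damped_binomial_sum_nonneg[of a l n] assms by (intro mult_right_mono) auto
  finally have "real k / real n * ?S k n \<le> ?S l n"
    using assms by (simp add: field_simps)
  moreover have "?S l n = real (n choose k) - a * ?S k n"
    using damped_binomial_sum_by_parts[of a l n] l by simp
  ultimately have "?S k n * (a + real k / real n) \<le> real (n choose k)"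
    by (simp add: algebra_simps)
  moreover have "a + real k / real n > 0" using assms by (intro add_nonneg_pos) auto
  ultimately show ?thesis by (simp add: pos_le_divide_eq)
qed

lemma binomial_le_power_div_fact: "real (n choose k) \<le> real n ^ k / fact k"
proof -
  have "fact k * (n choose k) \<le> n ^ k"
    using binomial_fact_pow[of n k] by (simp add: mult.commute)
  then have "real (fact k * (n choose k)) \<le> real (n ^ k)" by (rule of_nat_mono)
  then show ?thesis by (simp add: field_simps)
qed

text \<open>For \<open>k \<le> n\<close> the ratio of the falling factorial to the power is the product of the factors
  \<open>1 - i / n\<close> with \<open>i < k\<close>, hence at least one minus the sum of these \<open>i / n\<close>; for \<open>k > n\<close> the
  left side is negative.\<close>
lemma binomial_ge_power_div_fact:
  assumes "n > 0"
  shows "real n ^ k / fact k * (1 - (real k)\<^sup>2 / real n) \<le> real (n choose k)"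
proof (induction k)
  case (Suc k)
  let ?c = "real n ^ k / fact k"
  have absorb: "real (Suc k) * real (n choose Suc k) = (real n - real k) * real (n choose k)"
    by (rule choose_Suc_absorb)
  show ?case
  proof (cases "k < n")
    case False
    then have "real n * 1 \<le> real (Suc k) * real (Suc k)"
      by (intro mult_mono) auto
    then have "1 - (real (Suc k))\<^sup>2 / real n \<le> 0"
      using assms by (simp add: field_simps power2_eq_square)
    then have "real n ^ Suc k / fact (Suc k) * (1 - (real (Suc k))\<^sup>2 / real n) \<le> 0"
      by (intro mult_nonneg_nonpos) auto
    also have "\<dots> \<le> real (n choose Suc k)" by simp
    finally show ?thesis .
  next
    case True
    have "1 - (real (Suc k))\<^sup>2 / real n \<le> 1 - (real k)\<^sup>2 / real n - real k / real n"
      by (simp add: power2_eq_square add_divide_distrib algebra_simps)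
    also have "\<dots> \<le> 1 - (real k)\<^sup>2 / real n - real k / real n
        + (real k)\<^sup>2 / real n * (real k / real n)"
      by simp
    also have "\<dots> = (1 - (real k)\<^sup>2 / real n) * (1 - real k / real n)"
      by (simp only: left_diff_distrib right_diff_distrib)
    finally have "real n ^ Suc k / fact (Suc k) * (1 - (real (Suc k))\<^sup>2 / real n)
        \<le> real n ^ Suc k / fact (Suc k) * ((1 - (real k)\<^sup>2 / real n) * (1 - real k / real n))"
      by (intro mult_left_mono) auto
    also have "\<dots> = ?c * (1 - (real k)\<^sup>2 / real n) * ((real n - real k) / real (Suc k))"
      using assms by (simp add: divide_simps)
    also have "\<dots> \<le> real (n choose k) * ((real n - real k) / real (Suc k))"
      using True by (intro mult_right_mono Suc.IH) auto
    also have "\<dots> = real (n choose Suc k)"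
      using absorb by (simp add: field_simps del: of_nat_Suc)
    finally show ?thesis .
  qed
qed simp

section \<open>Stirling's formula with explicit bounds\<close>

definition stirling_defect :: "nat \<Rightarrow> real" where
  "stirling_defect k = ln (fact k) - ((real k + 1 / 2) * ln (real k) - real k)"

text \<open>The difference is \<open>(k + 1/2) (ln (k + 1) - ln k) - 1\<close>. The midpoint and trapezoidal rules for
  the integral of \<open>1 / x\<close> over \<open>[k, k + 1]\<close> bound the logarithm on either side, and the
  excess of the trapezoidal value is a telescoping expression.\<close>
lemma stirling_defect_diff:
  assumes "k > 0"
  shows "0 \<le> stirling_defect k - stirling_defect (Suc k)"
    and "stirling_defect k - stirling_defect (Suc k) \<le> 1 / (4 * real k) - 1 / (4 * real (Suc k))"
proof -
  let ?\<delta> = "ln (real k + 1) - ln (real k)"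
  have k: "real k > 0" using assms by simp
  have eq: "stirling_defect k - stirling_defect (Suc k) = (real k + 1 / 2) * ?\<delta> - 1"
  proof -
    have "ln (fact (Suc k)) = ln (real k + 1) + ln (fact k)"
      by (simp add: ln_mult add.commute del: of_nat_Suc)
    then show ?thesis by (simp add: stirling_defect_def algebra_simps del: fact_Suc)
  qed
  have "2 * (real k + 1 - real k) / (real k + (real k + 1)) \<le> ?\<delta>"
    using k by (intro ln_inverse_approx_ge) auto
  then have "1 \<le> (real k + 1 / 2) * ?\<delta>"
    using k by (simp add: field_simps)
  then show "0 \<le> stirling_defect k - stirling_defect (Suc k)" unfolding eq by simp
  have "?\<delta> \<le> (inverse (real k) + inverse (real k + 1)) / 2"
    using ln_inverse_approx_le[of "real k" 1] k by simp
  then have "(real k + 1 / 2) * ?\<delta>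
      \<le> (real k + 1 / 2) * ((inverse (real k) + inverse (real k + 1)) / 2)"
    using k by (intro mult_left_mono) auto
  also have "\<dots> - 1 = 1 / (4 * real k) - 1 / (4 * real (Suc k))"
    using k by (simp add: divide_simps) (simp add: algebra_simps)
  finally show "stirling_defect k - stirling_defect (Suc k)
      \<le> 1 / (4 * real k) - 1 / (4 * real (Suc k))"
    unfolding eq by simp
qed

lemma wallis_prod_eq:
  "(\<Prod>k=1..n. (4 * real k ^ 2) / (4 * real k ^ 2 - 1))
     = (2 ^ n * fact n) ^ 4 / (fact (2 * n) ^ 2 * (2 * real n + 1))"
proof (induction n)
  case (Suc n)
  define F :: real where "F = fact (2 * n)"
  have F: "F > 0" by (simp add: F_def)
  have fact: "fact (2 * Suc n) = 2 * (real n + 1) * (2 * real n + 1) * F"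
    by (simp add: F_def algebra_simps)
  have ratio: "4 * real (Suc n) ^ 2 / (4 * real (Suc n) ^ 2 - 1)
      = 4 * (real n + 1) ^ 2 / ((2 * real n + 1) * (2 * real n + 3))"
    by (simp add: power2_eq_square algebra_simps)
  have "(\<Prod>k=1..Suc n. (4 * real k ^ 2) / (4 * real k ^ 2 - 1))
      = (2 ^ n * fact n) ^ 4 / (F ^ 2 * (2 * real n + 1))
          * (4 * (real n + 1) ^ 2 / ((2 * real n + 1) * (2 * real n + 3)))"
    using Suc unfolding ratio[symmetric] by (simp add: F_def)
  also have "\<dots> = (2 * (real n + 1) * (2 ^ n * fact n)) ^ 4
      / ((2 * (real n + 1) * (2 * real n + 1) * F) ^ 2 * (2 * real n + 3))"
  proof -
    have "X ^ 4 / (F ^ 2 * A) * (4 * C ^ 2 / (A * B)) = (2 * C * X) ^ 4 / ((2 * C * A * F) ^ 2 * B)"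
      if "C \<noteq> 0" for A B C X
      using that by (simp add: power_mult_distrib power2_eq_square power4_eq_xxxx mult_ac)
    from this[of "real n + 1" "2 ^ n * fact n" "2 * real n + 1" "2 * real n + 3"]
    show ?thesis by simp
  qed
  moreover have "2 ^ Suc n * fact (Suc n) = 2 * (real n + 1) * (2 ^ n * fact n)"
    by (simp add: algebra_simps)
  moreover have "2 * real (Suc n) + 1 = 2 * real n + 3" by simp
  ultimately show ?case unfolding fact by presburger
qed simp

text \<open>The preceding lemma makes the defect converge; the limit comes from Wallis's product. In
  \<open>4 d\<^sub>n - 2 d\<^sub>2\<^sub>n\<close> the growing parts cancel, which leaves the logarithm of that product up to
  terms that tend to \<open>2 ln 2\<close>.\<close>
lemma stirling_defect_tendsto: "stirling_defect \<longlonglongrightarrow> ln (2 * pi) / 2"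
proof -
  let ?d = "\<lambda>k. stirling_defect (Suc k)"
  let ?e = "\<lambda>k. stirling_defect (Suc k) - 1 / (4 * real (Suc k))"
  have dec: "decseq ?d"
    using stirling_defect_diff(1) by (intro decseq_SucI) (simp add: le_diff_eq)
  have inc: "incseq ?e"
  proof (intro incseq_SucI)
    fix k show "?e k \<le> ?e (Suc k)" using stirling_defect_diff(2)[of "Suc k"] by simp
  qed
  have "?e 0 \<le> ?d k" for k
    by (rule order_trans[OF incseqD[OF inc, of 0 k]]) auto
  then obtain D where "?d \<longlonglongrightarrow> D"
    using decseq_convergent[OF dec, of "?e 0"] by blast
  then have D: "stirling_defect \<longlonglongrightarrow> D"
    by (simp only: filterlim_sequentially_Suc)
  have D2: "(\<lambda>n. stirling_defect (2 * n)) \<longlonglongrightarrow> D"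
    using LIMSEQ_subseq_LIMSEQ[OF D, of "\<lambda>n. 2 * n"] by (simp add: strict_mono_def o_def)
  let ?W = "\<lambda>n. \<Prod>k=1..n. (4 * real k ^ 2) / (4 * real k ^ 2 - 1)"
  have lnW: "ln (?W n) = 4 * stirling_defect n - 2 * stirling_defect (2 * n)
      + (ln (real n) - ln 2 - ln (2 * real n + 1))" if "n > 0" for n
  proof -
    have "ln (?W n) = 4 * (real n * ln 2 + ln (fact n)) - (2 * ln (fact (2 * n)) + ln (2 * real n + 1))"
      unfolding wallis_prod_eq by (simp add: ln_div ln_mult ln_realpow)
    also have "ln (fact n) = stirling_defect n + ((real n + 1 / 2) * ln (real n) - real n)"
      by (simp add: stirling_defect_def)
    also have "ln (fact (2 * n)) = stirling_defect (2 * n)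
        + ((2 * real n + 1 / 2) * (ln 2 + ln (real n)) - 2 * real n)"
      using that by (simp add: stirling_defect_def ln_mult)
    finally show ?thesis by (simp add: algebra_simps)
  qed
  have "(\<lambda>n. 4 * stirling_defect n - 2 * stirling_defect (2 * n)
      + (ln (real n) - ln 2 - ln (2 * real n + 1))) \<longlonglongrightarrow> 4 * D - 2 * D + (- 2 * ln 2)"
  proof (intro tendsto_intros D D2)
    show "(\<lambda>n. ln (real n) - ln 2 - ln (2 * real n + 1)) \<longlonglongrightarrow> - 2 * ln 2"
      by real_asymp
  qed
  moreover have "(\<lambda>n. ln (?W n)) \<longlonglongrightarrow> ln (pi / 2)"
    using wallis by (intro tendsto_ln) auto
  then have "(\<lambda>n. 4 * stirling_defect n - 2 * stirling_defect (2 * n)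
      + (ln (real n) - ln 2 - ln (2 * real n + 1))) \<longlonglongrightarrow> ln (pi / 2)"
    by (rule Lim_transform_eventually) (rule eventually_mono[OF eventually_gt_at_top[of 0] lnW])
  ultimately have "4 * D - 2 * D + (- 2 * ln 2) = ln (pi / 2)"
    by (rule LIMSEQ_unique)
  then have "D = ln (2 * pi) / 2" by (simp add: ln_div ln_mult)
  then show ?thesis using D by (simp only:)
qed

lemma stirling_bounds:
  assumes "k > 0"
  shows "sqrt (2 * pi * real k) * exp (real k * ln (real k) - real k) \<le> fact k"
    and "fact k \<le> sqrt (2 * pi * real k) * exp (real k * ln (real k) - real k) * exp (1 / (4 * real k))"
proof -
  let ?D = "ln (2 * pi) / 2"
  have lower: "?D \<le> stirling_defect k"
  proof (rule LIMSEQ_le_const2[OF stirling_defect_tendsto])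
    have "stirling_defect n \<le> stirling_defect k" if "k \<le> n" for n
      using that
    proof (induction n rule: dec_induct)
      case (step n)
      then show ?case using stirling_defect_diff(1)[of n] assms by simp
    qed simp
    then show "\<exists>N. \<forall>n\<ge>N. stirling_defect n \<le> stirling_defect k" by blast
  qed
  have "stirling_defect k - 1 / (4 * real k) \<le> ?D - 0"
  proof (rule LIMSEQ_le_const)
    show "(\<lambda>n. stirling_defect n - 1 / (4 * real n)) \<longlonglongrightarrow> ?D - 0"
      by (intro tendsto_diff stirling_defect_tendsto) real_asymp
    have "stirling_defect k - 1 / (4 * real k) \<le> stirling_defect n - 1 / (4 * real n)" if "k \<le> n" for n
      using that
    proof (induction n rule: dec_induct)
      case (step n)
      then show ?case using stirling_defect_diff(2)[of n] assms by linarith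
    qed simp
    then show "\<exists>N. \<forall>n\<ge>N. stirling_defect k - 1 / (4 * real k) \<le> stirling_defect n - 1 / (4 * real n)"
      by blast
  qed
  then have upper: "stirling_defect k \<le> ?D + 1 / (4 * real k)" by simp
  have sqrt: "sqrt (2 * pi * real k) = exp (?D + ln (real k) / 2)"
    using assms by (simp add: powr_half_sqrt[symmetric] powr_def ln_mult add_divide_distrib)
  have fact: "fact k = exp (stirling_defect k + ((real k + 1 / 2) * ln (real k) - real k))"
    by (simp add: stirling_defect_def)
  show "sqrt (2 * pi * real k) * exp (real k * ln (real k) - real k) \<le> fact k"
    unfolding sqrt fact exp_add[symmetric] using lower by (simp add: algebra_simps)
  show "fact k \<le> sqrt (2 * pi * real k) * exp (real k * ln (real k) - real k) * exp (1 / (4 * real k))"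
    unfolding sqrt fact exp_add[symmetric] using upper by (simp add: algebra_simps)
qed

section \<open>Comparison of a single term with its limiting profile\<close>

text \<open>The sum \<open>S\<^sub>k\<close> in units of \<open>(n / L)\<^bsup>k+1\<^esup> e\<^sup>L / sqrt (2 \<pi> L)\<close>, which is
  \<open>n\<^bsup>k+1\<^esup> / (k! L)\<close> with \<open>k!\<close> replaced by \<open>sqrt (2 \<pi> L) L\<^sup>k e\<^bsup>-L\<^esup>\<close>. In the central range of \<open>k\<close> the value is
  close to \<open>1 / (1 + a n / L)\<close>.\<close>
definition scaled_sum :: "real \<Rightarrow> real \<Rightarrow> nat \<Rightarrow> nat \<Rightarrow> real" where
  "scaled_sum L a k n
     = damped_binomial_sum a k n * (L / real n) ^ Suc k * exp (- L) * sqrt (2 * pi * L)"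

lemma scaled_sum_nonneg: "a \<le> 1 \<Longrightarrow> L > 0 \<Longrightarrow> scaled_sum L a k n \<ge> 0"
  by (simp add: scaled_sum_def damped_binomial_sum_nonneg)

lemma power_div_fact_le_exp:
  assumes "(x::real) \<ge> 0"
  shows "x ^ m / fact m \<le> exp x"
proof -
  have "(\<lambda>i. x ^ i / fact i) sums exp x"
    using exp_converges[of x] by (simp add: field_simps)
  then show ?thesis
    using sum_le_suminf[of "\<lambda>i. x ^ i / fact i" "{m}"] assms
    by (simp add: sums_iff)
qed

text \<open>A bound for all \<open>k\<close>, too large by a factor of order \<open>sqrt L\<close>. It serves for the tails,
  where the Gaussian weight makes up for the loss.\<close>
lemma scaled_sum_le:
  assumes "0 \<le> a" "a \<le> 1" "L > 0" "n > 0"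
  shows "scaled_sum L a k n \<le> sqrt (2 * pi * L)"
proof -
  have "scaled_sum L a k n
      \<le> real n ^ Suc k / fact (Suc k) * (L / real n) ^ Suc k * exp (- L) * sqrt (2 * pi * L)"
    unfolding scaled_sum_def
    using damped_binomial_sum_le_choose[OF assms(1,2), of k n] binomial_le_power_div_fact[of n "Suc k"]
      assms by (intro mult_right_mono) auto
  also have "\<dots> = L ^ Suc k / fact (Suc k) * exp (- L) * sqrt (2 * pi * L)"
    using assms by (simp add: power_divide)
  also have "\<dots> \<le> exp L * exp (- L) * sqrt (2 * pi * L)"
    using assms power_div_fact_le_exp[of L "Suc k"] by (intro mult_right_mono) auto
  also have "\<dots> = sqrt (2 * pi * L)" by (simp flip: exp_add)
  finally show ?thesis .
qed

lemma power_exp_eq: "L > 0 \<Longrightarrow> (L::real) ^ k * exp (- L) = exp (real k * ln L - L)"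
  by (simp add: exp_diff exp_minus exp_of_nat_mult divide_inverse)

text \<open>By convexity, \<open>x ln x - x\<close> lies above its tangent \<open>x ln L - L\<close> at \<open>L\<close>, so that
  Stirling's lower bound for \<open>k!\<close> may be evaluated at \<open>L\<close> instead of \<open>k\<close>. What remains is
  powers of \<open>L / k \<ge> 1\<close>.\<close>
lemma scaled_sum_upper:
  assumes "0 \<le> a" "a \<le> 1" "0 < k" "real k \<le> L" "n > 0"
  shows "scaled_sum L a k n \<le> (L / real k)\<^sup>2 / (1 + a * real n / L)"
proof -
  define c where "c = a * real n / L"
  have L: "L > 0" "real k > 0" "L / real k \<ge> 1" using assms by auto
  have c: "c \<ge> 0" "a = c * L / real n" using assms L by (auto simp: c_def)
  have pos: "1 + c > 0" "c * L + real k > 0"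
    using c L by (auto intro: add_nonneg_pos)
  define E where "E = L ^ k * exp (- L)"
  have E: "E > 0" using L by (simp add: E_def)
  have "ln (L / real k) \<le> L / real k - 1" using L by (intro ln_le_minus_one) auto
  then have "real k * (ln L - ln (real k)) \<le> real k * (L / real k - 1)"
    using L by (intro mult_left_mono) (auto simp: ln_div)
  then have "real k * ln L - L \<le> real k * ln (real k) - real k"
    using L by (simp add: algebra_simps)
  then have "sqrt (2 * pi * real k) * E \<le> sqrt (2 * pi * real k) * exp (real k * ln (real k) - real k)"
    unfolding E_def power_exp_eq[OF L(1)] by (intro mult_left_mono) auto
  also have "\<dots> \<le> fact k" using stirling_bounds(1) assms by simp
  finally have fact: "sqrt (2 * pi * real k) * E \<le> fact k" .
  have "damped_binomial_sum a k n \<le> real (n choose k) / (a + real k / real n)"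
    by (rule damped_binomial_sum_upper) (use assms in auto)
  also have "\<dots> \<le> real n ^ k / fact k / (a + real k / real n)"
    using assms by (intro divide_right_mono binomial_le_power_div_fact) auto
  also have "\<dots> = real n ^ Suc k / (fact k * (c * L + real k))"
    using assms by (simp add: c(2) divide_simps)
  finally have "scaled_sum L a k n
      \<le> real n ^ Suc k / (fact k * (c * L + real k)) * (L / real n) ^ Suc k * exp (- L) * sqrt (2 * pi * L)"
    unfolding scaled_sum_def using L by (intro mult_right_mono) auto
  also have "\<dots> = L * E * sqrt (2 * pi * L) / (fact k * (c * L + real k))"
    using assms by (simp add: power_divide E_def)
  also have "\<dots> \<le> L * E * sqrt (2 * pi * L) / ((sqrt (2 * pi * real k) * E) * (real k * (1 + c)))"
  proof (intro divide_left_mono mult_mono fact)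
    show "real k * (1 + c) \<le> c * L + real k"
      using assms c mult_left_mono[of "real k" L c] by (simp add: algebra_simps)
  qed (use L c E pos in \<open>auto intro!: mult_pos_pos mult_nonneg_nonneg\<close>)
  also have "\<dots> = (L / real k) * sqrt (L / real k) / (1 + c)"
    unfolding real_sqrt_mult real_sqrt_divide using E by (simp add: mult_ac)
  also have "\<dots> \<le> (L / real k) * (L / real k) / (1 + c)"
  proof (intro divide_right_mono mult_left_mono)
    have "1 * (L / real k) \<le> L / real k * (L / real k)"
      using L by (intro mult_right_mono) auto
    then have "L / real k \<le> (L / real k)\<^sup>2" by (simp only: power2_eq_square mult_1_left)
    then show "sqrt (L / real k) \<le> L / real k" using L by (intro real_le_lsqrt) auto
  qed (use L c in auto)
  finally show ?thesis by (simp add: c_def power2_eq_square)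
qed

text \<open>Four losses add up: \<open>(k - L)\<^sup>2 / L\<close> from the tangent of \<open>x ln x - x\<close> at \<open>L\<close>, which
  fails to be exact by at most that much, \<open>1 / (4 k)\<close> from Stirling's upper bound, \<open>1 / L\<close> from
  \<open>k + 1 \<le> L + 1\<close>, and \<open>(k + 1)\<^sup>2 / n\<close> from the replacement of the binomial coefficient by a
  power.\<close>
lemma scaled_sum_lower:
  assumes "0 \<le> a" "a \<le> 1" "0 < k" "real k \<le> L" "n > 0"
  shows "(1 - (real k - L)\<^sup>2 / L - 1 / (4 * real k) - 1 / L - (real k + 1)\<^sup>2 / real n)
           / (1 + a * real n / L) \<le> scaled_sum L a k n"
proof -
  define c where "c = a * real n / L"
  define x where "x = (real k - L)\<^sup>2 / L + 1 / (4 * real k)"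
  define y where "y = 1 / L"
  define d where "d = (real k + 1)\<^sup>2 / real n"
  have L: "L > 0" "real k > 0" "L \<ge> 1" using assms by auto
  have c: "c \<ge> 0" "a * real n = c * L" using assms L by (auto simp: c_def)
  have xyd: "x \<ge> 0" "y \<ge> 0" "d \<ge> 0" using L by (auto simp: x_def y_def d_def)
  have "(1 - x - y - d) / (1 + c) \<le> scaled_sum L a k n"
  proof (cases "1 - x - y - d \<le> 0")
    case True
    then have "(1 - x - y - d) / (1 + c) \<le> 0" using c by (simp add: divide_nonpos_nonneg)
    also have "\<dots> \<le> scaled_sum L a k n" using assms L by (intro scaled_sum_nonneg) auto
    finally show ?thesis .
  next
    case False
    then have le1: "x \<le> 1" "y \<le> 1" "d \<le> 1" using xyd by linarith+
    define E where "E = L ^ k * exp (- L)"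
    have E: "E > 0" using L by (simp add: E_def)
    have "ln (real k / L) \<le> real k / L - 1" using L by (intro ln_le_minus_one) auto
    then have "real k * (ln (real k) - ln L) \<le> real k * (real k / L - 1)"
      using L by (intro mult_left_mono) (auto simp: ln_div)
    then have "real k * ln (real k) - real k \<le> real k * ln L - L + (real k - L)\<^sup>2 / L"
      using L by (simp add: field_simps power2_eq_square)
    then have expo: "exp (real k * ln (real k) - real k) * exp (1 / (4 * real k)) \<le> E * exp x"
      unfolding E_def power_exp_eq[OF L(1)] exp_add[symmetric] x_def by simp
    have "fact k \<le> sqrt (2 * pi * real k) * (exp (real k * ln (real k) - real k) * exp (1 / (4 * real k)))"
      using stirling_bounds(2)[of k] assms by (simp add: mult.assoc)
    also have "\<dots> \<le> sqrt (2 * pi * L) * (E * exp x)"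
      by (rule mult_mono[OF _ expo]) (use assms in auto)
    finally have fact: "fact k \<le> sqrt (2 * pi * L) * (E * exp x)" .
    \<comment> \<open>The errors enter as factors; a product of numbers in the unit interval is at least one
      minus the sum of their defects.\<close>
    have "1 - x - y - d \<le> (1 - d) * ((1 - x) * (1 - y))"
    proof -
      have "0 \<le> x * y + d * (x * (1 - y) + y)"
        using xyd le1 by (intro add_nonneg_nonneg mult_nonneg_nonneg) auto
      then show ?thesis by (simp add: algebra_simps)
    qed
    also have "\<dots> \<le> (1 - d) * (exp (- x) * (L / (L + 1)))"
    proof (intro mult_left_mono mult_mono)
      show "1 - x \<le> exp (- x)" using exp_ge_add_one_self[of "- x"] by simp
      show "1 - y \<le> L / (L + 1)" using L by (simp add: y_def field_simps)
    qed (use le1 in auto)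
    finally have "(1 - x - y - d) / (1 + c) \<le> (1 - d) * (exp (- x) * (L / (L + 1))) / (1 + c)"
      using c by (intro divide_right_mono) auto
    also have "\<dots> = (1 - d) * (L * E * sqrt (2 * pi * L)
        / ((sqrt (2 * pi * L) * (E * exp x)) * ((L + 1) * (1 + c))))"
      using L E by (simp add: exp_minus divide_simps)
    also have "\<dots> \<le> (1 - d) * (L * E * sqrt (2 * pi * L) / (fact k * (real k + 1 + c * L)))"
    proof (intro mult_left_mono divide_left_mono mult_mono fact)
      have "real k + 1 + c * L \<le> L + 1 + c * L + c" using assms c by simp
      then show "real k + 1 + c * L \<le> (L + 1) * (1 + c)" by (simp add: algebra_simps)
    qed (use L c E le1 in \<open>auto intro!: mult_pos_pos add_pos_nonneg mult_nonneg_nonneg add_nonneg_nonneg\<close>)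
    also have "\<dots> = real n ^ Suc k / fact (Suc k) * (1 - d) / (1 + a * real n / real (Suc k))
        * (L / real n) ^ Suc k * exp (- L) * sqrt (2 * pi * L)"
    proof -
      have "(1 + a * real n / real (Suc k)) = (real k + 1 + c * L) / real (Suc k)"
        by (simp add: c(2) add_divide_distrib[symmetric] divide_simps)
      then show ?thesis
        using assms by (simp add: E_def power_divide)
    qed
    also have "\<dots> \<le> damped_binomial_sum a k n * (L / real n) ^ Suc k * exp (- L) * sqrt (2 * pi * L)"
    proof (intro mult_right_mono)
      have "real n ^ Suc k / fact (Suc k) * (1 - d) / (1 + a * real n / real (Suc k))
          \<le> real (n choose Suc k) / (1 + a * real n / real (Suc k))"
        using binomial_ge_power_div_fact[of n "Suc k"] assms
        by (intro divide_right_mono) (auto simp: d_def add.commute)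
      also have "\<dots> \<le> damped_binomial_sum a k n"
        by (rule damped_binomial_sum_lower) (use assms in auto)
      finally show "real n ^ Suc k / fact (Suc k) * (1 - d) / (1 + a * real n / real (Suc k))
          \<le> damped_binomial_sum a k n" .
    qed (use L in auto)
    finally show ?thesis by (simp add: scaled_sum_def)
  qed
  then show ?thesis by (simp add: x_def y_def d_def c_def diff_diff_eq)
qed

text \<open>The dominant loss is \<open>(k - L)\<^sup>2 / L \<le> 4 W\<^sup>2 / L\<close> from below; the upper bound contributes only
  \<open>O(W / L)\<close>. The range of \<open>k\<close> is \<open>\<bar>k - u\<bar> \<le> W\<close> with \<open>u = L - W\<close>, chosen such that \<open>k\<close>
  does not exceed \<open>L\<close>.\<close>
lemma scaled_sum_window:
  assumes "0 \<le> a" "a \<le> 1" "n > 0" and W: "1 \<le> W" "4 * W \<le> L"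
    and k: "L - 2 * W \<le> real k" "real k \<le> L" and n: "(L + 1)\<^sup>2 * L \<le> real n"
  shows "\<bar>scaled_sum L a k n - 1 / (1 + a * real n / L)\<bar> \<le> 12 * W\<^sup>2 / L"
proof -
  define c where "c = a * real n / L"
  have L: "L \<ge> 4" "L > 0" using W by auto
  have kL: "L / 2 \<le> real k" "0 < real k" "0 < k" using W k by linarith+
  have c: "c \<ge> 0" using assms L by (auto simp: c_def)
  have WW: "W \<le> W\<^sup>2" "1 \<le> W\<^sup>2" using W one_le_power[of W 2] by (auto simp: power2_eq_square)
  have damp: "x / (1 + c) \<le> x" if "x \<ge> 0" for x
    using divide_left_mono[of 1 "1 + c" x] c that by simp
  have "scaled_sum L a k n - 1 / (1 + c) \<le> ((L / real k)\<^sup>2 - 1) / (1 + c)"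
    using scaled_sum_upper[OF assms(1,2) kL(3) k(2) assms(3)] by (simp add: c_def diff_divide_distrib)
  also have "\<dots> \<le> (L / real k)\<^sup>2 - 1"
    using kL k by (intro damp) simp
  also have "\<dots> \<le> 12 * W / L"
  proof -
    define t where "t = 4 * W / L"
    have t: "0 \<le> t" "t \<le> 1" using W L by (auto simp: t_def)
    have "L / real k - 1 = (L - real k) / real k" using kL by (simp add: diff_divide_distrib)
    also have "\<dots> \<le> (2 * W) / (L / 2)" using k kL L W by (intro frac_le) auto
    finally have "L / real k \<le> 1 + t" by (simp add: t_def)
    then have "(L / real k)\<^sup>2 \<le> (1 + t)\<^sup>2" using kL L by (intro power_mono) auto
    also have "\<dots> \<le> 1 + 3 * t" using t mult_left_mono[of t 1 t] by (simp add: power2_eq_square algebra_simps)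
    finally show ?thesis by (simp add: t_def)
  qed
  also have "\<dots> \<le> 12 * W\<^sup>2 / L" using WW L by (simp add: divide_right_mono)
  finally have upper: "scaled_sum L a k n - 1 / (1 + c) \<le> 12 * W\<^sup>2 / L" .
  define e where "e = (real k - L)\<^sup>2 / L + 1 / (4 * real k) + 1 / L + (real k + 1)\<^sup>2 / real n"
  have "1 / (1 + c) - scaled_sum L a k n \<le> e / (1 + c)"
    using scaled_sum_lower[OF assms(1,2) kL(3) k(2) assms(3)]
    by (simp add: c_def e_def diff_divide_distrib add_divide_distrib)
  also have "\<dots> \<le> e" using L by (intro damp) (auto simp: e_def)
  also have "e \<le> (2 * W)\<^sup>2 / L + 1 / (2 * L) + 1 / L + 1 / L"
    unfolding e_def
  proof (intro add_mono)
    have "\<bar>real k - L\<bar> \<le> 2 * W" using k by simp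
    then have "(real k - L)\<^sup>2 \<le> (2 * W)\<^sup>2" by (intro abs_le_square_iff[THEN iffD1]) auto
    then show "(real k - L)\<^sup>2 / L \<le> (2 * W)\<^sup>2 / L" using L by (intro divide_right_mono) auto
    show "1 / (4 * real k) \<le> 1 / (2 * L)" using kL L by (intro divide_left_mono) auto
    have "(real k + 1)\<^sup>2 * L \<le> (L + 1)\<^sup>2 * L" using k L by (intro mult_right_mono power_mono) auto
    then have "(real k + 1)\<^sup>2 * L \<le> real n" using n by linarith
    then show "(real k + 1)\<^sup>2 / real n \<le> 1 / L" using L assms(3) by (simp add: field_simps)
  qed simp
  also have "\<dots> = (4 * W\<^sup>2 + 5 / 2) / L" using L by (simp add: field_simps)
  also have "\<dots> \<le> 12 * W\<^sup>2 / L" using WW L by (intro divide_right_mono) auto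
  finally show ?thesis using upper by (simp add: c_def abs_le_iff)
qed

section \<open>The oscillating factor as a sum over a shifted lattice\<close>

definition cost_profile :: "real \<Rightarrow> real \<Rightarrow> real" where
  "cost_profile q w = q powr ((w\<^sup>2 + w) / 2) / (1 + q powr w)"

text \<open>Half of the Gaussian exponent of the profile. The other half, \<open>q\<^bsup>w\<^sup>2/4\<^esup>\<close>, is kept to make
  the tails small.\<close>
definition profile_majorant :: "real \<Rightarrow> real \<Rightarrow> real" where
  "profile_majorant q w = q powr (w\<^sup>2 / 4 + w / 2)"

lemma cost_profile_nonneg: "cost_profile q w \<ge> 0"
  by (simp add: cost_profile_def)

lemma cost_profile_le_gaussian: "cost_profile q w \<le> q powr ((w\<^sup>2 + w) / 2)"
  using divide_left_mono[of 1 "1 + q powr w" "q powr ((w\<^sup>2 + w) / 2)"]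
  by (simp add: cost_profile_def add_pos_nonneg)

lemma gaussian_le_majorant:
  assumes "0 < q" "q < 1" "0 \<le> W" "W \<le> \<bar>w\<bar>"
  shows "q powr ((w\<^sup>2 + w) / 2) \<le> q powr (W\<^sup>2 / 4) * profile_majorant q w"
proof -
  have "W\<^sup>2 \<le> w\<^sup>2" using assms by (metis abs_of_nonneg abs_le_square_iff)
  then have "W\<^sup>2 / 4 + (w\<^sup>2 / 4 + w / 2) \<le> (w\<^sup>2 + w) / 2"
    by (simp add: field_simps)
  then show ?thesis
    unfolding profile_majorant_def powr_add[symmetric] using assms by (intro powr_mono') auto
qed

lemma summable_on_powr_abs_int:
  fixes q :: real
  assumes "0 < q" "q < 1"
  shows "(\<lambda>j::int. q powr \<bar>real_of_int j\<bar>) summable_on UNIV"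
proof -
  have geo: "(\<lambda>n::nat. q ^ n) summable_on UNIV"
    using assms by (intro summable_nonneg_imp_summable_on) auto
  have "(\<lambda>j::int. q powr \<bar>real_of_int j\<bar>) summable_on range int"
    by (subst summable_on_reindex) (use geo assms in \<open>auto simp: o_def powr_realpow\<close>)
  moreover have "(\<lambda>j::int. q powr \<bar>real_of_int j\<bar>) summable_on range (\<lambda>n. - int n)"
    by (subst summable_on_reindex) (use geo assms in \<open>auto simp: o_def powr_realpow inj_def\<close>)
  moreover have "UNIV = range int \<union> range (\<lambda>n. - int n)"
    by (auto simp: image_iff) (metis int_cases2)
  ultimately show ?thesis using summable_on_union by metis
qed

text \<open>The parabola \<open>w\<^sup>2 / 4 + w / 2\<close> lies above its tangents \<open>w - 1/4\<close> and \<open>- w - 9/4\<close> of slopes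
  \<open>\<plusminus> 1\<close>; passing from \<open>w\<close> to \<open>j\<close> costs at most \<open>1\<close> more.\<close>
lemma majorant_frac_le:
  assumes "0 < q" "q < 1" "0 \<le> \<theta>" "\<theta> \<le> 1"
  shows "profile_majorant q (real_of_int j - \<theta>) \<le> q powr (- 13 / 4) * q powr \<bar>real_of_int j\<bar>"
proof -
  define w where "w = real_of_int j - \<theta>"
  have "(w / 2 - 1 / 2)\<^sup>2 \<ge> 0" "(w / 2 + 3 / 2)\<^sup>2 \<ge> 0" by simp_all
  then have "w\<^sup>2 / 4 + w / 2 \<ge> w - 1 / 4" "w\<^sup>2 / 4 + w / 2 \<ge> - w - 9 / 4"
    by (simp_all add: power2_eq_square algebra_simps) 
  then have "- 13 / 4 + \<bar>real_of_int j\<bar> \<le> w\<^sup>2 / 4 + w / 2"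
    using assms unfolding w_def by linarith
  then show ?thesis
    unfolding profile_majorant_def powr_add[symmetric] w_def[symmetric]
    using assms by (intro powr_mono') auto
qed

definition majorant_total :: "real \<Rightarrow> real" where
  "majorant_total q = q powr (- 13 / 4) * (\<Sum>\<^sub>\<infinity>j::int. q powr \<bar>real_of_int j\<bar>)"

text \<open>The bound must not depend on \<open>u\<close>. Shifting the index by \<open>\<lfloor>u\<rfloor>\<close> reduces the claim to offsets
  in the unit interval.\<close>
lemma majorant_sum:
  assumes "0 < q" "q < 1"
  shows "(\<lambda>k::int. profile_majorant q (real_of_int k - u)) summable_on UNIV"
    and "(\<Sum>\<^sub>\<infinity>k::int. profile_majorant q (real_of_int k - u)) \<le> majorant_total q"
proof -
  let ?f = "\<lambda>k::int. profile_majorant q (real_of_int k - u)"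
  let ?g = "\<lambda>j::int. profile_majorant q (real_of_int j - frac u)"
  let ?h = "\<lambda>j::int. q powr (- 13 / 4) * q powr \<bar>real_of_int j\<bar>"
  have fg: "?f (j + \<lfloor>u\<rfloor>) = ?g j" for j by (simp add: frac_def algebra_simps)
  have le: "?g j \<le> ?h j" for j
    using assms frac_lt_1[of u] by (intro majorant_frac_le) auto
  have h: "?h summable_on UNIV"
    by (intro summable_on_cmult_right summable_on_powr_abs_int assms)
  have g: "?g summable_on UNIV"
    by (rule summable_on_comparison_test[OF h]) (use le in \<open>auto simp: profile_majorant_def\<close>)
  show "?f summable_on UNIV"
    using summable_on_reindex_bij_betw[OF bij_plus_right[of "\<lfloor>u\<rfloor>"], of ?f] g unfolding fg by simp
  have "infsum ?f UNIV = infsum ?g UNIV"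
    using infsum_reindex_bij_betw[OF bij_plus_right[of "\<lfloor>u\<rfloor>"], of ?f] unfolding fg by simp
  also have "\<dots> \<le> infsum ?h UNIV" by (intro infsum_mono g h le)
  also have "\<dots> = majorant_total q"
    unfolding majorant_total_def by (intro infsum_cmult_right summable_on_powr_abs_int assms)
  finally show "infsum ?f UNIV \<le> majorant_total q" .
qed

lemma cost_profile_le_majorant:
  assumes "0 < q" "q < 1"
  shows "cost_profile q w \<le> profile_majorant q w"
  using cost_profile_le_gaussian[of q w] gaussian_le_majorant[of q 0 w] assms by simp

lemma cost_profile_summable:
  assumes "0 < q" "q < 1"
  shows "(\<lambda>k::int. cost_profile q (real_of_int k - u)) summable_on UNIV"
  by (rule summable_on_comparison_test[OF majorant_sum(1)[OF assms, of u]])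
     (use cost_profile_le_majorant[OF assms] cost_profile_nonneg in auto)

text \<open>With \<open>w = j - frac u\<close>, the exponent \<open>(w\<^sup>2 + w) / 2\<close> splits into the part
  in front of the sum in the definition of \<open>G\<close> and the two exponents in its terms.\<close>
lemma G_summand_eq:
  assumes "0 < q"
  shows "q powr (((frac u)\<^sup>2 - frac u) / 2) * G_summand q u j
           = cost_profile q (real_of_int (j + \<lfloor>u\<rfloor>) - u)"
proof -
  have w: "real_of_int (j + \<lfloor>u\<rfloor>) - u = real_of_int j - frac u" by (simp add: frac_def)
  have e: "((real_of_int j - frac u)\<^sup>2 + (real_of_int j - frac u)) / 2
      = ((frac u)\<^sup>2 - frac u) / 2 + (real_of_int (j * (j + 1)) / 2 + - (real_of_int j * frac u))"
    by (simp add: power2_eq_square field_simps)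
  show ?thesis
    unfolding w cost_profile_def e powr_add G_summand_def by simp
qed

lemma G_summand_summable:
  assumes "0 < q" "q < 1"
  shows "G_summand q u summable_on UNIV"
proof -
  have "(\<lambda>j. cost_profile q (real_of_int (j + \<lfloor>u\<rfloor>) - u)) summable_on UNIV"
    using summable_on_reindex_bij_betw[OF bij_plus_right[of "\<lfloor>u\<rfloor>"],
        of "\<lambda>k. cost_profile q (real_of_int k - u)"]
      cost_profile_summable[OF assms] by simp
  then show ?thesis
    unfolding G_summand_eq[OF assms(1), symmetric] using assms
    by (subst (asm) summable_on_cmult_right') auto
qed

lemma G_eq_profile_sum:
  assumes "0 < q" "q < 1"
  shows "G q u = (\<Sum>\<^sub>\<infinity>k::int. cost_profile q (real_of_int k - u))"
proof -
  have "G q u = (\<Sum>\<^sub>\<infinity>j::int. cost_profile q (real_of_int (j + \<lfloor>u\<rfloor>) - u))"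
    unfolding G_def G_summand_eq[OF assms(1), symmetric]
    by (rule infsum_cmult_right[symmetric]) (rule G_summand_summable[OF assms])
  then show ?thesis
    using infsum_reindex_bij_betw[OF bij_plus_right[of "\<lfloor>u\<rfloor>"],
        of "\<lambda>k. cost_profile q (real_of_int k - u)"] by simp
qed

lemma G_le:
  assumes "0 < q" "q < 1"
  shows "G q u \<le> majorant_total q"
proof -
  have "G q u \<le> (\<Sum>\<^sub>\<infinity>k::int. profile_majorant q (real_of_int k - u))"
    unfolding G_eq_profile_sum[OF assms]
    by (intro infsum_mono cost_profile_summable majorant_sum(1) cost_profile_le_majorant assms)
  then show ?thesis using majorant_sum(2)[OF assms, of u] by simp
qed

text \<open>A positive lower bound is what turns an additive error into a relative one. The single term
  \<open>k = \<lfloor>u\<rfloor>\<close> provides it: there \<open>-1 \<le> w \<le> 0\<close>, so that \<open>w\<^sup>2 + w \<le> 0\<close>.\<close>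
lemma G_ge:
  assumes "0 < q" "q < 1"
  shows "q / (1 + q) \<le> G q u"
proof -
  define w where "w = - frac u"
  have w: "- 1 \<le> w" "w \<le> 0" using frac_lt_1[of u] by (auto simp: w_def)
  have "w\<^sup>2 + w = w * (w + 1)" by (simp add: power2_eq_square algebra_simps)
  also have "\<dots> \<le> 0" using w by (intro mult_nonpos_nonneg) auto
  finally have "q powr 0 \<le> q powr ((w\<^sup>2 + w) / 2)" using assms by (intro powr_mono') auto
  moreover have "q powr w \<le> q powr (- 1)" using assms w by (intro powr_mono') auto
  ultimately have "1 / (1 + q powr (- 1)) \<le> cost_profile q w"
    unfolding cost_profile_def using assms by (intro frac_le) (auto intro: add_pos_nonneg)
  moreover have "1 / (1 + q powr (- 1)) = q / (1 + q)"
    using assms by (simp add: powr_minus field_simps)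
  moreover have "cost_profile q w = (\<Sum>\<^sub>\<infinity>k\<in>{\<lfloor>u\<rfloor>}. cost_profile q (real_of_int k - u))"
    by (simp add: w_def frac_def)
  moreover have "\<dots> \<le> G q u"
    unfolding G_eq_profile_sum[OF assms]
    by (intro infsum_mono2 cost_profile_summable assms) (auto simp: cost_profile_nonneg)
  ultimately show ?thesis by simp
qed

section \<open>Asymptotics of the cost\<close>

text \<open>The asserted approximation without its oscillating factor.\<close>
definition cost_scale :: "real \<Rightarrow> real \<Rightarrow> real" where
  "cost_scale \<kappa> x = 1 / sqrt (2 * pi) * (x powr (1 / ln \<kappa> + 1 / 2) / log \<kappa> x)
     * exp ((ln (x / log \<kappa> x))\<^sup>2 / (2 * ln \<kappa>))"

text \<open>An exact identity. With \<open>\<lambda> = ln \<kappa>\<close>, everything is a power of \<open>e\<close>: \<open>q\<^sup>k = e\<^bsup>-\<lambda>k\<^esup>\<close>,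
  \<open>n / L = e\<^bsup>\<lambda>u\<^esup>\<close>, and the scale times \<open>sqrt (2 \<pi> L)\<close> is
  \<open>e\<^bsup>L + \<lambda>u(u+1)/2\<^esup>\<close>. The second claim amounts to the completed square
  \<open>k (k + 1) - 2 u (k + 1) + u (u + 1) = (k - u)\<^sup>2 + (k - u)\<close>.\<close>
lemma cost_summand_eq_scaled:
  fixes q :: real and n k :: nat
  defines "L \<equiv> log (1 / q) (real n)"
  defines "w \<equiv> real k - log (1 / q) (real n / L)"
  assumes q: "0 < q" "q < 1" and n: "n > 1"
  shows "q ^ k * real n / L = q powr w" (is ?weight)
    and "cost_summand q n k
           = cost_scale (1 / q) (real n) * (q powr ((w\<^sup>2 + w) / 2) * scaled_sum L (q ^ k) k n)"
      (is ?summand)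
proof -
  define lam where "lam = ln (1 / q)"
  have lam: "lam > 0" "ln q = - lam" using q by (auto simp: lam_def ln_div)
  have L: "L > 0" using n lam by (simp add: L_def log_def flip: lam_def)
  define u where "u = log (1 / q) (real n / L)"
  have lnn: "ln (real n) = lam * L" using lam by (simp add: L_def log_def flip: lam_def)
  have lnnL: "ln (real n / L) = lam * u" using lam by (simp add: u_def log_def flip: lam_def)
  then have nL: "real n / L = exp (lam * u)" using L n by (metis divide_pos_pos exp_ln gr0I not_less_zero of_nat_0_less_iff)
  have lnL: "ln L = lam * L - lam * u" using lnnL L n lnn by (simp add: ln_div)
  have w: "w = real k - u" by (simp add: w_def u_def)
  have qk: "q ^ m = exp (- lam * real m)" for m
    using q lam by (metis exp_ln exp_of_nat_mult mult.commute)
  show ?weight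
    using q lam(2) by (simp add: qk nL powr_def w times_divide_eq_right[symmetric] exp_add[symmetric]
        del: times_divide_eq_right) (simp add: algebra_simps)
  have sqrtL: "sqrt L = exp (ln L / 2)" using L by (simp add: powr_half_sqrt[symmetric] powr_def)
  have tri: "real (k * (k + 1) div 2) = (real k * (real k + 1)) / 2"
    by (subst real_of_nat_div) (auto simp: algebra_simps)
  define S where "S = damped_binomial_sum (q ^ k) k n"
  have scale: "cost_scale (1 / q) (real n) * sqrt (2 * pi * L) = exp (L + lam * u * (u + 1) / 2)"
  proof -
    define P where "P = real n powr (1 / lam + 1 / 2)"
    define E where "E = exp ((lam * u)\<^sup>2 / (2 * lam))"
    have "cost_scale (1 / q) (real n) = 1 / sqrt (2 * pi) * (P / L) * E"
      unfolding cost_scale_def lam_def[symmetric] L_def[symmetric] lnnL P_def E_def ..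
    then have "cost_scale (1 / q) (real n) * sqrt (2 * pi * L) = P * (sqrt L / L) * E"
      unfolding real_sqrt_mult by simp
    also have "sqrt L / L = 1 / sqrt L"
      using sqrt_divide_self_eq[of L] L by (simp add: inverse_eq_divide)
    finally have "cost_scale (1 / q) (real n) * sqrt (2 * pi * L) = P * (1 / sqrt L) * E" .
    also have "\<dots> = exp ((1 / lam + 1 / 2) * (lam * L) - (lam * L - lam * u) / 2 + lam * u\<^sup>2 / 2)"
    proof -
      have "P = exp ((1 / lam + 1 / 2) * (lam * L))" using n by (simp add: P_def powr_def lnn)
      moreover have "1 / sqrt L = exp (- ((lam * L - lam * u) / 2))"
        unfolding sqrtL lnL exp_minus inverse_eq_divide ..
      moreover have "E = exp (lam * u\<^sup>2 / 2)" using lam by (simp add: E_def power2_eq_square)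
      ultimately show ?thesis by (simp only: exp_add[symmetric]) (simp add: algebra_simps)
    qed
    also have "(1 / lam + 1 / 2) * (lam * L) - (lam * L - lam * u) / 2 + lam * u\<^sup>2 / 2
        = L + lam * u * (u + 1) / 2"
      using lam by (simp add: field_simps power2_eq_square)
    finally show ?thesis .
  qed
  have "cost_scale (1 / q) (real n) * (q powr ((w\<^sup>2 + w) / 2) * scaled_sum L (q ^ k) k n)
      = S * ((cost_scale (1 / q) (real n) * sqrt (2 * pi * L)) * q powr ((w\<^sup>2 + w) / 2)
          * (L / real n) ^ Suc k * exp (- L))"
    by (simp add: scaled_sum_def S_def mult_ac)
  also have "(L / real n) ^ Suc k = exp (- lam * u * real (Suc k))"
  proof -
    have "L / real n = exp (- lam * u)" using nL by (simp add: exp_minus flip: nL)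
    then show ?thesis by (simp only: exp_of_nat2_mult)
  qed
  also have "(cost_scale (1 / q) (real n) * sqrt (2 * pi * L)) * q powr ((w\<^sup>2 + w) / 2)
      * exp (- lam * u * real (Suc k)) * exp (- L) = exp (- lam * (real k * (real k + 1) / 2))"
    unfolding scale using q lam(2)
    by (simp add: powr_def exp_add[symmetric] w) (simp add: field_simps power2_eq_square)
  also have "\<dots> = q ^ (k * (k + 1) div 2)" by (simp only: qk tri)
  finally show ?summand by (simp add: cost_summand_def S_def)
qed

text \<open>One bound for all \<open>k\<close>: \<open>scaled_sum_window\<close> covers the centre, and beyond it the two
  quantities are small separately. The hypotheses about \<open>n\<close> hold for all large \<open>n\<close>.\<close>
lemma cost_summand_approx:
  fixes q :: real and n k :: nat
  defines "L \<equiv> log (1 / q) (real n)"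
  defines "W \<equiv> log (1 / q) L"
  defines "w \<equiv> real k - log (1 / q) (real n / L)"
  assumes q: "0 < q" "q < 1" and n: "n > 1"
    and W: "1 \<le> W" "4 * W \<le> L" and big: "(L + 1)\<^sup>2 * L \<le> real n"
    and tail: "q powr (W\<^sup>2 / 4) * (sqrt (2 * pi * L) + 1) \<le> 12 * W\<^sup>2 / L"
  shows "\<bar>cost_summand q n k / cost_scale (1 / q) (real n) - cost_profile q w\<bar>
           \<le> 12 * W\<^sup>2 / L * profile_majorant q w"
proof -
  have L: "L > 0" using W by simp
  define \<gamma> where "\<gamma> = q powr ((w\<^sup>2 + w) / 2)"
  define R where "R = scaled_sum L (q ^ k) k n"
  have \<gamma>: "\<gamma> \<ge> 0" by (simp add: \<gamma>_def)
  have weight: "q ^ k * real n / L = q powr w"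
    unfolding L_def w_def by (rule cost_summand_eq_scaled(1)[OF q n])
  have scale_pos: "cost_scale (1 / q) (real n) > 0"
    using L n by (simp add: cost_scale_def L_def)
  have "cost_summand q n k = cost_scale (1 / q) (real n) * (\<gamma> * R)"
    unfolding \<gamma>_def R_def L_def w_def by (rule cost_summand_eq_scaled(2)[OF q n])
  then have "cost_summand q n k / cost_scale (1 / q) (real n) - cost_profile q w
      = \<gamma> * (R - 1 / (1 + q powr w))"
    using scale_pos by (simp add: cost_profile_def \<gamma>_def right_diff_distrib)
  then have diff: "\<bar>cost_summand q n k / cost_scale (1 / q) (real n) - cost_profile q w\<bar>
      = \<gamma> * \<bar>R - 1 / (1 + q powr w)\<bar>"
    using \<gamma> by (simp add: abs_mult)
  have qk: "0 \<le> q ^ k" "q ^ k \<le> 1" using q by (auto simp: power_le_one)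
  show ?thesis
  proof (cases "\<bar>w\<bar> \<le> W")
    case True
    have "log (1 / q) (real n / L) = L - W"
      using n L by (simp add: L_def W_def log_divide)
    then have k: "L - 2 * W \<le> real k" "real k \<le> L" using True by (auto simp: w_def)
    have "\<bar>R - 1 / (1 + q powr w)\<bar> \<le> 12 * W\<^sup>2 / L"
      unfolding weight[symmetric] R_def
      by (rule scaled_sum_window) (use qk n W k big in auto)
    moreover have "\<gamma> \<le> profile_majorant q w"
      using gaussian_le_majorant[of q 0 w] q by (simp add: \<gamma>_def)
    ultimately show ?thesis
      unfolding diff using \<gamma> by (subst mult.commute) (intro mult_mono, auto)
  next
    case False
    have "\<bar>R - 1 / (1 + q powr w)\<bar> \<le> sqrt (2 * pi * L) + 1"
    proof -
      have "0 \<le> R" unfolding R_def using qk L by (intro scaled_sum_nonneg) auto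
      moreover have "R \<le> sqrt (2 * pi * L)"
        unfolding R_def using qk L n by (intro scaled_sum_le) auto
      moreover have "0 \<le> 1 / (1 + q powr w)" "1 / (1 + q powr w) \<le> 1"
        by (auto simp: divide_le_eq_1 add_pos_nonneg)
      ultimately show ?thesis by linarith
    qed
    moreover have "\<gamma> \<le> q powr (W\<^sup>2 / 4) * profile_majorant q w"
      unfolding \<gamma>_def using False W q by (intro gaussian_le_majorant) auto
    ultimately have "\<gamma> * \<bar>R - 1 / (1 + q powr w)\<bar>
        \<le> q powr (W\<^sup>2 / 4) * profile_majorant q w * (sqrt (2 * pi * L) + 1)"
      using L by (intro mult_mono) (auto simp: profile_majorant_def)
    also have "\<dots> = q powr (W\<^sup>2 / 4) * (sqrt (2 * pi * L) + 1) * profile_majorant q w"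
      by simp
    also have "\<dots> \<le> 12 * W\<^sup>2 / L * profile_majorant q w"
      by (intro mult_right_mono tail) (simp add: profile_majorant_def)
    finally show ?thesis unfolding diff .
  qed
qed

text \<open>The termwise bound is summed over all integers, the exact formula being extended by zero. For
  negative \<open>k\<close> the profile alone must be small, which it is because \<open>u = L - W \<ge> W\<close>.\<close>
lemma mis_cost_approx:
  fixes p q :: real and n :: nat
  defines "L \<equiv> log (1 / q) (real n)"
  defines "W \<equiv> log (1 / q) L"
  assumes q_def: "q = 1 - p" and q: "0 < q" "q < 1" and n: "n > 1"
    and W: "1 \<le> W" "4 * W \<le> L" and big: "(L + 1)\<^sup>2 * L \<le> real n"
    and tail: "q powr (W\<^sup>2 / 4) * (sqrt (2 * pi * L) + 1) \<le> 12 * W\<^sup>2 / L"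
  shows "\<bar>mis_cost p n / cost_scale (1 / q) (real n) - G q (log (1 / q) (real n / L))\<bar>
           \<le> 12 * W\<^sup>2 / L * majorant_total q"
proof -
  define u where "u = log (1 / q) (real n / L)"
  define K where "K = cost_scale (1 / q) (real n)"
  define A where "A = (\<lambda>k::int. if k < 0 then 0 else cost_summand q n (nat k) / K)"
  let ?f = "\<lambda>k::int. cost_profile q (real_of_int k - u)"
  let ?m = "\<lambda>k::int. profile_majorant q (real_of_int k - u)"
  have L: "L > 0" using W by simp
  have u: "u = L - W" using n L by (simp add: u_def L_def W_def log_divide)
  have approx: "\<bar>A k - ?f k\<bar> \<le> 12 * W\<^sup>2 / L * ?m k" for k
  proof (cases "k < 0")
    case True
    have "W \<le> \<bar>real_of_int k - u\<bar>" using True W unfolding u by linarith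
    then have "?f k \<le> q powr (W\<^sup>2 / 4) * 1 * ?m k"
      using cost_profile_le_gaussian[of q "real_of_int k - u"]
        gaussian_le_majorant[OF q, of W "real_of_int k - u"] W by simp
    also have "\<dots> \<le> q powr (W\<^sup>2 / 4) * (sqrt (2 * pi * L) + 1) * ?m k"
      using L by (intro mult_right_mono mult_left_mono) (auto simp: profile_majorant_def)
    also have "\<dots> \<le> 12 * W\<^sup>2 / L * ?m k"
      by (intro mult_right_mono tail) (simp add: profile_majorant_def)
    finally show ?thesis
      using True cost_profile_nonneg[of q "real_of_int k - u"] by (simp add: A_def)
  next
    case False
    then show ?thesis
      using cost_summand_approx[of q n "nat k"] q n W big tail
      by (simp add: A_def K_def u_def L_def W_def)
  qed
  have Asum: "(A has_sum (mis_cost p n / K)) UNIV"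
  proof (rule has_sum_finite_neutralI[of "int ` {..<n}"])
    show "A x = 0" if "x \<in> UNIV - int ` {..<n}" for x
    proof (cases "x < 0")
      case False
      then have "n \<le> nat x" using that by (metis DiffE image_eqI lessThan_iff not_le nat_0_le)
      then show ?thesis by (simp add: A_def cost_summand_eq_0)
    qed (simp add: A_def)
    show "mis_cost p n / K = sum A (int ` {..<n})"
      by (simp add: sum.reindex A_def mis_cost_eq_sum sum_divide_distrib q_def)
  qed auto
  have f: "?f summable_on UNIV" by (rule cost_profile_summable[OF q])
  have m: "(\<lambda>k. 12 * W\<^sup>2 / L * ?m k) summable_on UNIV"
    by (intro summable_on_cmult_right majorant_sum(1)[OF q])
  have "((\<lambda>k. - ?f k) has_sum (- G q u)) UNIV"
    using f by (simp add: has_sum_uminus G_eq_profile_sum[OF q])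
  from has_sum_add[OF Asum this]
  have diff: "((\<lambda>k. A k - ?f k) has_sum (mis_cost p n / K - G q u)) UNIV" by simp
  have "\<bar>mis_cost p n / K - G q u\<bar> \<le> (\<Sum>\<^sub>\<infinity>k. 12 * W\<^sup>2 / L * ?m k)"
    using norm_infsum_le[OF diff has_sum_infsum[OF m]] approx by simp
  also have "\<dots> = 12 * W\<^sup>2 / L * (\<Sum>\<^sub>\<infinity>k. ?m k)"
    by (intro infsum_cmult_right majorant_sum(1)[OF q])
  also have "\<dots> \<le> 12 * W\<^sup>2 / L * majorant_total q"
    using L by (intro mult_left_mono majorant_sum(2)[OF q]) auto
  finally show ?thesis by (simp add: K_def u_def)
qed

lemma eventually_mis_cost_approx:
  fixes p q :: real
  assumes p: "0 < p" "p < 1" and q_def: "q = 1 - p"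
  shows "\<forall>\<^sub>F n in sequentially.
    \<bar>mis_cost p n / cost_scale (1 / q) (real n) - G q (log (1 / q) (real n / log (1 / q) (real n)))\<bar>
      \<le> 12 * majorant_total q * ((log (1 / q) (log (1 / q) (real n)))\<^sup>2 / log (1 / q) (real n))"
proof -
  define lam where "lam = ln (1 / q)"
  have q: "0 < q" "q < 1" using p q_def by auto
  have lam: "lam > 0" "q = exp (- lam)" using q by (auto simp: lam_def ln_div)
  let ?L = "\<lambda>x. ln x / lam" and ?W = "\<lambda>x. ln (ln x / lam) / lam"
  have "\<forall>\<^sub>F n in sequentially. 1 \<le> ?W (real n)"
    using lam(1) by real_asymp
  moreover have "\<forall>\<^sub>F n in sequentially. 4 * ?W (real n) \<le> ?L (real n)"
    using lam(1) by real_asymp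
  moreover have "\<forall>\<^sub>F n in sequentially. (?L (real n) + 1)\<^sup>2 * ?L (real n) \<le> real n"
    using lam(1) by real_asymp
  moreover have "\<forall>\<^sub>F n in sequentially. exp (- lam * (?W (real n))\<^sup>2 / 4) * (sqrt (2 * pi * ?L (real n)) + 1)
      \<le> 12 * (?W (real n))\<^sup>2 / ?L (real n)"
    using lam(1) by real_asymp
  ultimately show ?thesis
    using eventually_gt_at_top[of 1]
  proof eventually_elim
    case (elim n)
    have "\<bar>mis_cost p n / cost_scale (1 / q) (real n) - G q (log (1 / q) (real n / log (1 / q) (real n)))\<bar>
      \<le> 12 * (log (1 / q) (log (1 / q) (real n)))\<^sup>2 / log (1 / q) (real n) * majorant_total q"
    proof (rule mis_cost_approx[OF q_def q])
      show "q powr ((log (1 / q) (log (1 / q) (real n)))\<^sup>2 / 4) * (sqrt (2 * pi * log (1 / q) (real n)) + 1)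
         \<le> 12 * (log (1 / q) (log (1 / q) (real n)))\<^sup>2 / log (1 / q) (real n)"
        using elim by (simp add: log_def flip: lam_def) (simp add: lam(2) powr_def mult_ac)
    qed (use elim in \<open>auto simp: log_def simp flip: lam_def\<close>)
    then show ?case by (simp add: mult_ac)
  qed
qed

theorem theorem2p1:
  fixes p q \<kappa> :: real
  assumes "0 < p" and "p < 1" and "q = 1 - p" and "\<kappa> = 1 / q"
  shows "(\<forall>u. G_summand q u summable_on UNIV) \<and>
    bounded (range (G q)) \<and>
    (\<forall>u. G q (u + 1) = G q u) \<and>
    (\<exists>\<epsilon> :: nat \<Rightarrow> real.
       \<epsilon> \<in> O(\<lambda>n. (ln (ln (real n)))\<^sup>2 / ln (real n)) \<and>
       (\<forall>\<^sub>F n in sequentially.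
          mis_cost p n =
            G q (log \<kappa> (real n / log \<kappa> (real n))) / sqrt (2 * pi)
            * (real n powr (1 / ln \<kappa> + 1 / 2) / log \<kappa> (real n))
            * exp ((ln (real n / log \<kappa> (real n)))\<^sup>2 / (2 * ln \<kappa>))
            * (1 + \<epsilon> n)))"
proof (intro conjI allI)
  have q: "0 < q" "q < 1" using assms by auto
  have G_pos: "G q u > 0" for u
    using G_ge[OF q, of u] q by (smt (verit) divide_pos_pos)
  show "G_summand q u summable_on UNIV" for u by (rule G_summand_summable[OF q])
  show "bounded (range (G q))"
    by (rule boundedI[of _ "majorant_total q"]) (use G_le[OF q] G_pos in \<open>auto simp: less_imp_le\<close>)
  show "G q (u + 1) = G q u" for u
  proof -
    have "frac (u + 1) = frac u" by (simp add: frac_def)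
    moreover from this have "G_summand q (u + 1) = G_summand q u"
      by (simp add: G_summand_def fun_eq_iff)
    ultimately show ?thesis by (simp add: G_def)
  qed
  define L where "L = (\<lambda>n::nat. log \<kappa> (real n))"
  define g where "g = (\<lambda>n. G q (log \<kappa> (real n / L n)))"
  define K where "K = (\<lambda>n::nat. cost_scale \<kappa> (real n))"
  define \<epsilon> where "\<epsilon> = (\<lambda>n. mis_cost p n / (K n * g n) - 1)"
  have \<kappa>: "\<kappa> > 1" using assms q by simp
  show "\<exists>\<epsilon> :: nat \<Rightarrow> real.
       \<epsilon> \<in> O(\<lambda>n. (ln (ln (real n)))\<^sup>2 / ln (real n)) \<and>
       (\<forall>\<^sub>F n in sequentially.
          mis_cost p n =
            G q (log \<kappa> (real n / log \<kappa> (real n))) / sqrt (2 * pi)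
            * (real n powr (1 / ln \<kappa> + 1 / 2) / log \<kappa> (real n))
            * exp ((ln (real n / log \<kappa> (real n)))\<^sup>2 / (2 * ln \<kappa>))
            * (1 + \<epsilon> n))"
  proof (intro exI[of _ \<epsilon>] conjI)
    have K_pos: "K n > 0" if "n > 1" for n
      using that \<kappa> by (simp add: K_def cost_scale_def)
    show "\<forall>\<^sub>F n in sequentially.
          mis_cost p n =
            G q (log \<kappa> (real n / log \<kappa> (real n))) / sqrt (2 * pi)
            * (real n powr (1 / ln \<kappa> + 1 / 2) / log \<kappa> (real n))
            * exp ((ln (real n / log \<kappa> (real n)))\<^sup>2 / (2 * ln \<kappa>))
            * (1 + \<epsilon> n)"
      using eventually_gt_at_top[of 1]
    proof eventually_elim
      case (elim n)
      have "mis_cost p n = g n * K n * (1 + \<epsilon> n)"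
        using K_pos[OF elim] G_pos[of "log \<kappa> (real n / L n)"] by (simp add: \<epsilon>_def g_def)
      then show ?case by (simp add: g_def K_def L_def cost_scale_def mult_ac)
    qed
    have "\<epsilon> \<in> O(\<lambda>n. (log \<kappa> (L n))\<^sup>2 / L n)"
    proof (rule bigoI)
      show "\<forall>\<^sub>F n in sequentially. norm (\<epsilon> n)
          \<le> 12 * majorant_total q / (q / (1 + q)) * norm ((log \<kappa> (L n))\<^sup>2 / L n)"
        using eventually_mis_cost_approx[OF assms(1-3)] eventually_gt_at_top[of 1]
      proof eventually_elim
        case (elim n)
        define X where "X = mis_cost p n / K n"
        have "\<bar>X - g n\<bar> \<le> 12 * majorant_total q * ((log \<kappa> (L n))\<^sup>2 / L n)"
          using elim by (simp add: X_def g_def L_def K_def assms(4))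
        moreover have "L n > 0" using elim \<kappa> by (simp add: L_def)
        ultimately have X: "\<bar>X - g n\<bar> \<le> 12 * majorant_total q * norm ((log \<kappa> (L n))\<^sup>2 / L n)"
          by simp
        have g: "q / (1 + q) \<le> g n" "g n > 0" "q / (1 + q) > 0"
          using G_ge[OF q] G_pos q by (auto simp: g_def)
        have "\<epsilon> n = (X - g n) / g n"
          using g K_pos[OF elim(2)] by (simp add: \<epsilon>_def X_def diff_divide_distrib)
        then have "norm (\<epsilon> n) = \<bar>X - g n\<bar> / g n" using g by simp
        also have "\<dots> \<le> 12 * majorant_total q * norm ((log \<kappa> (L n))\<^sup>2 / L n) / (q / (1 + q))"
          by (rule frac_le[OF order_trans[OF abs_ge_zero X] X g(3) g(1)])
        finally show ?case by (simp only: times_divide_eq_left)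
      qed
    qed
    also have "(\<lambda>n. (log \<kappa> (L n))\<^sup>2 / L n) \<in> O(\<lambda>n. (ln (ln (real n)))\<^sup>2 / ln (real n))"
    proof -
      have "ln \<kappa> > 0" using \<kappa> by simp
      then show ?thesis unfolding L_def log_def by real_asymp
    qed
    finally show "\<epsilon> \<in> O(\<lambda>n. (ln (ln (real n)))\<^sup>2 / ln (real n))" .
  qed
qed

end
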